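(* Let $n\ge 2$, let $P_n$ be the polycyclic monoid on $n$ generators, and let $a,b\in P_n$. Then $a\sim_p b$ if and only if one of the following conditions is satisfied: (a) $a=\rho(b)=0$ or $\rho(a)=b=0$; (b) $\rho(a)=\rho(b)=0$ and $\widetilde a=\widetilde b$; (c) $\widetilde a,\widetilde b\in A_n^*$ and $\widetilde a\sim_p\widetilde b$ in the free monoid $A_n^*$; or (d) $\widetilde a,\widetilde b\in (A_n^{-1})^*$ and $\widetilde a\sim_p\widetilde b$ in the free monoid $(A_n^{-1})^*$.
   Context: For elements $a,b$ of a monoid $M$, $a\sim_p b$ means that there exist $u,v\in M$ with $a=uv$ and $b=vu$. Polycyclic monoid: let $n\ge2$, $A_n=\{p_1,\dots,p_n\}$, $A_n^{-1}=\{p_1^{-1},\dots,p_n^{-1}\}$ a disjoint copy, $\Sigma=A_n\cup A_n^{-1}$, $\Sigma_0=\Sigma\cup\{0\}$. Put $(p_i^{-1})^{-1}=p_i$, $1^{-1}=1$ (where $1$ is the empty word), and $(xw)^{-1}=w^{-1}x^{-1}$ for $x\in\Sigma$, $w\in\Sigma^*$. $P_n$ is the monoid generated by $\Sigma_0$ with defining relations (read as left-to-right rewriting rules) $p_i^{-1}p_i=1$, $p_i^{-1}p_j=0$ for $i\ne j$, and $x0=0$, $0x=0$, $00=0$ for $x\in\Sigma$. The element $0$ is the zero of $P_n$. Each nonzero element of $P_n$ is represented by a unique irreducible word, which has the form $yx^{-1}$ with $x,y\in A_n^*$; elements of $P_n$ are identified with their irreducible words ($0$ being the irreducible word for the zero).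 An irreducible word is cyclically reduced if it is empty or $0$, or if its first letter $c$ and last letter $d$ satisfy $c\ne d^{-1}$. For $a\in P_n$ the word $\widetilde a$ is defined by: $\widetilde a=a$ if $a$ is cyclically reduced; otherwise write $a=r\,yx^{-1}\,r^{-1}$ with $r,x,y\in A_n^*$ and $yx^{-1}$ cyclically reduced (such a decomposition exists and is unique), and put $\widetilde a=yx^{-1}$. For a nonzero $a=yx^{-1}\in P_n$ ($x,y\in A_n^*$), $\rho(a)$ denotes the irreducible word obtained by reducing $x^{-1}y$ in $P_n$ (possibly $0$); also $\rho(0)=0$. *)

theory Defs
  imports "HOL-Algebra.Group"
begin

definition pconj :: "('a, 'm) monoid_scheme \<Rightarrow> 'a \<Rightarrow> 'a \<Rightarrow> bool" where
  "pconj M a b \<longleftrightarrow>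
     (\<exists>u \<in> carrier M. \<exists>v \<in> carrier M. a = u \<otimes>\<^bsub>M\<^esub> v \<and> b = v \<otimes>\<^bsub>M\<^esub> u)"

definition free_monoid :: "'a set \<Rightarrow> 'a list monoid" where
  "free_monoid X = \<lparr>carrier = lists X, mult = (@), one = []\<rparr>"

datatype letter = Gen nat | GenInv nat | Zero

type_synonym word = "letter list"

definition gens :: "nat \<Rightarrow> letter set" where
  "gens n = Gen ` {1..n}"

definition inv_gens :: "nat \<Rightarrow> letter set" where
  "inv_gens n = GenInv ` {1..n}"

definition Sig :: "nat \<Rightarrow> letter set" where
  "Sig n = gens n \<union> inv_gens n"

definition Sig0 :: "nat \<Rightarrow> letter set" where
  "Sig0 n = Sig n \<union> {Zero}"

text \<open>Inversion is only meant for letters other than \<open>Zero\<close>; the last equation is a dummy value.\<close>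
primrec inv_letter :: "letter \<Rightarrow> letter" where
  "inv_letter (Gen i) = GenInv i"
| "inv_letter (GenInv i) = Gen i"
| "inv_letter Zero = Zero"

primrec inv_word :: "word \<Rightarrow> word" where
  "inv_word [] = []"
| "inv_word (x # w) = inv_word w @ [inv_letter x]"

definition rules :: "nat \<Rightarrow> (word \<times> word) set" where
  "rules n =
     {([GenInv i, Gen i], []) | i. i \<in> {1..n}} \<union>
     {([GenInv i, Gen j], [Zero]) | i j. i \<in> {1..n} \<and> j \<in> {1..n} \<and> i \<noteq> j} \<union>
     {([x, Zero], [Zero]) | x. x \<in> Sig n} \<union>
     {([Zero, x], [Zero]) | x. x \<in> Sig n} \<union>
     {([Zero, Zero], [Zero])}"

definition step :: "nat \<Rightarrow> (word \<times> word) set" where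
  "step n = {(u @ l @ v, u @ r @ v) | u v l r.
     u \<in> lists (Sig0 n) \<and> v \<in> lists (Sig0 n) \<and> (l, r) \<in> rules n}"

text \<open>The monoid congruence on the free monoid over \<open>Sig0 n\<close> generated by the rules.  The
  restriction only removes reflexive pairs of lists that are not words over \<open>Sig0 n\<close>.\<close>
definition cong_rel :: "nat \<Rightarrow> (word \<times> word) set" where
  "cong_rel n = (step n \<union> (step n)\<inverse>)\<^sup>* \<inter> lists (Sig0 n) \<times> lists (Sig0 n)"

definition polycyclic :: "nat \<Rightarrow> word set monoid" where
  "polycyclic n =
     \<lparr>carrier = lists (Sig0 n) // cong_rel n,
      mult = (\<lambda>X Y. \<Union>u \<in> X. \<Union>v \<in> Y. cong_rel n `` {u @ v}),
      one = cong_rel n `` {[]}\<rparr>"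

definition irreducible_word :: "nat \<Rightarrow> word \<Rightarrow> bool" where
  "irreducible_word n w \<longleftrightarrow> w \<in> lists (Sig0 n) \<and> (\<nexists>v. (w, v) \<in> step n)"

definition reduce :: "nat \<Rightarrow> word \<Rightarrow> word" where
  "reduce n w = (THE v. (w, v) \<in> (step n)\<^sup>* \<and> irreducible_word n v)"

text \<open>The irreducible word with which an element of the polycyclic monoid is identified.\<close>
definition irr :: "nat \<Rightarrow> word set \<Rightarrow> word" where
  "irr n a = (THE w. w \<in> a \<and> irreducible_word n w)"

definition cyclically_reduced :: "nat \<Rightarrow> word \<Rightarrow> bool" where
  "cyclically_reduced n w \<longleftrightarrow>
     irreducible_word n w \<and> (w = [] \<or> w = [Zero] \<or> hd w \<noteq> inv_letter (last w))"

text \<open>The functions \<open>tilde\<close> and \<open>rho\<close> are meant for irreducible words only.\<close>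

definition tilde :: "nat \<Rightarrow> word \<Rightarrow> word" where
  "tilde n w =
     (if cyclically_reduced n w then w
      else THE t. \<exists>r \<in> lists (gens n). \<exists>x \<in> lists (gens n). \<exists>y \<in> lists (gens n).
        t = y @ inv_word x \<and> cyclically_reduced n t \<and> w = r @ t @ inv_word r)"

definition rho :: "nat \<Rightarrow> word \<Rightarrow> word" where
  "rho n w =
     (if w = [Zero] then [Zero]
      else THE v. \<exists>x \<in> lists (gens n). \<exists>y \<in> lists (gens n).
        w = y @ inv_word x \<and> v = reduce n (inv_word x @ y))"

end

theory Submission
  imports Defs "HOL-Library.Sublist"
begin

text \<open>A normal form \<open>y x\<^sup>-\<^sup>1\<close> is stored as the pair \<open>(y, x)\<close> of index lists, and the zero
  as \<open>None\<close>. Letters act on normal forms by left multiplication, and this action respects the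
  defining relations, which replaces a proof of confluence. In terms of normal forms, \<open>\<rho>\<close> vanishes
  iff \<open>x\<close> and \<open>y\<close> are prefix-incomparable, and \<open>tilde\<close> strips the longest common prefix of \<open>x\<close>
  and \<open>y\<close>. The theorem then follows by computing \<open>uv\<close> and \<open>vu\<close> for \<open>u = y\<^sub>1 x\<^sub>1\<^sup>-\<^sup>1\<close> and
  \<open>v = y\<^sub>2 x\<^sub>2\<^sup>-\<^sup>1\<close>, according to how \<open>x\<^sub>1\<close> compares with \<open>y\<^sub>2\<close> and \<open>x\<^sub>2\<close> with \<open>y\<^sub>1\<close>.\<close>

section \<open>Normal forms and the action of letters on them\<close>

type_synonym nform = "(nat list \<times> nat list) option"

definition valid :: "nat \<Rightarrow> nform \<Rightarrow> bool" where
  "valid n s \<longleftrightarrow> (\<forall>y x. s = Some (y, x) \<longrightarrow> set y \<subseteq> {1..n} \<and> set x \<subseteq> {1..n})"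

lemma valid_simps [simp]:
  "valid n None"
  "valid n (Some (y, x)) \<longleftrightarrow> set y \<subseteq> {1..n} \<and> set x \<subseteq> {1..n}"
  by (auto simp: valid_def)

fun word_of :: "nform \<Rightarrow> word" where
  "word_of None = [Zero]"
| "word_of (Some (y, x)) = map Gen y @ rev (map GenInv x)"

text \<open>The clause with empty left component encodes \<open>p_i^-1 x^-1 = (x p_i)^-1\<close>, so
  the new index goes to the end of \<open>x\<close>.\<close>

fun act :: "letter \<Rightarrow> nform \<Rightarrow> nform" where
  "act _ None = None"
| "act Zero (Some _) = None"
| "act (Gen i) (Some (y, x)) = Some (i # y, x)"
| "act (GenInv i) (Some ([], x)) = Some ([], x @ [i])"
| "act (GenInv i) (Some (j # y, x)) = (if i = j then Some (y, x) else None)"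

definition nf :: "word \<Rightarrow> nform" where
  "nf w = foldr act w (Some ([], []))"

lemma nf_append: "nf (u @ v) = foldr act u (nf v)"
  by (simp add: nf_def)

lemma Sig0_iff:
  "Gen i \<in> Sig0 n \<longleftrightarrow> i \<in> {1..n}" "GenInv i \<in> Sig0 n \<longleftrightarrow> i \<in> {1..n}" "Zero \<in> Sig0 n"
  by (auto simp: Sig0_def Sig_def gens_def inv_gens_def)

lemma lists_gens: "lists (gens n) = map Gen ` {x. set x \<subseteq> {1..n}}"
  by (simp only: gens_def lists_image) (simp only: lists_eq_set)

lemma inv_word_map_Gen [simp]: "inv_word (map Gen x) = rev (map GenInv x)"
  by (induction x) auto

lemma valid_act: "c \<in> Sig0 n \<Longrightarrow> valid n s \<Longrightarrow> valid n (act c s)"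
  by (cases "(c, s)" rule: act.cases) (auto simp: Sig0_iff)

lemma valid_nf: "w \<in> lists (Sig0 n) \<Longrightarrow> valid n (nf w)"
  by (induction w) (auto simp: nf_def intro: valid_act)

lemma word_of_in_lists: "valid n s \<Longrightarrow> word_of s \<in> lists (Sig0 n)"
  by (cases s rule: word_of.cases) (auto simp: Sig0_iff subset_iff)

lemma foldr_act_None [simp]: "foldr act w None = None"
  by (induction w) auto

lemma foldr_act_Gen [simp]: "foldr act (map Gen w) (Some (y, x)) = Some (w @ y, x)"
  by (induction w) auto

lemma foldr_act_GenInv_Nil [simp]:
  "foldr act (rev (map GenInv w)) (Some ([], x)) = Some ([], x @ w)"
  by (induction w arbitrary: x) auto

lemma nf_word_of [simp]: "nf (word_of s) = s"
  by (cases s rule: word_of.cases) (auto simp: nf_def)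

lemma word_of_inject [simp]: "word_of s = word_of t \<longleftrightarrow> s = t"
  by (metis nf_word_of)

section \<open>Rewriting and normal forms\<close>

lemma rules_cases:
  assumes "(l, r) \<in> rules n"
  obtains i where "l = [GenInv i, Gen i]" "r = []" "i \<in> {1..n}"
  | i j where "l = [GenInv i, Gen j]" "r = [Zero]" "i \<in> {1..n}" "j \<in> {1..n}" "i \<noteq> j"
  | x where "l = [x, Zero]" "r = [Zero]" "x \<in> Sig n"
  | x where "l = [Zero, x]" "r = [Zero]" "x \<in> Sig n"
  | "l = [Zero, Zero]" "r = [Zero]"
  using assms by (auto simp: rules_def)

lemma act_Zero [simp]: "act Zero s = None"
  by (cases s) auto

text \<open>Replaces a confluence check: the two sides of a rule act alike on every normal form, so
  \<open>nf\<close> is constant along rewriting.\<close>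

lemma foldr_act_rules:
  assumes "(l, r) \<in> rules n" shows "foldr act l s = foldr act r s"
  using assms by (cases rule: rules_cases; cases s rule: word_of.cases) auto

lemma nf_step: "(u, v) \<in> step n \<Longrightarrow> nf u = nf v"
  by (auto simp: step_def nf_append foldr_act_rules)

lemma nf_steps: "(u, v) \<in> (step n)\<^sup>* \<Longrightarrow> nf u = nf v"
  by (induction rule: rtrancl_induct) (auto dest: nf_step)

lemma length_step: "(u, v) \<in> step n \<Longrightarrow> length v < length u"
  by (auto simp: step_def elim!: rules_cases)

lemma length_steps: "(u, v) \<in> (step n)\<^sup>* \<Longrightarrow> length v \<le> length u"
  by (induction rule: rtrancl_induct) (auto dest!: length_step)

lemma step_in_lists: "(u, v) \<in> step n \<Longrightarrow> v \<in> lists (Sig0 n)"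
  by (auto simp: step_def Sig0_iff elim!: rules_cases)

lemma step_Cons: "c \<in> Sig0 n \<Longrightarrow> (u, v) \<in> step n \<Longrightarrow> (c # u, c # v) \<in> step n"
  unfolding step_def mem_Collect_eq prod.inject by (metis lists.Cons append_Cons)

lemma steps_Cons: "(u, v) \<in> (step n)\<^sup>* \<Longrightarrow> c \<in> Sig0 n \<Longrightarrow> (c # u, c # v) \<in> (step n)\<^sup>*"
  by (induction rule: rtrancl_induct) (auto intro: step_Cons rtrancl_into_rtrancl)

lemma step_rule_append:
  "(l, r) \<in> rules n \<Longrightarrow> v \<in> lists (Sig0 n) \<Longrightarrow> (l @ v, r @ v) \<in> step n"
  unfolding step_def mem_Collect_eq prod.inject by (metis lists.Nil append_Nil)

lemma Zero_absorbs:
  "w \<in> lists (Sig0 n) \<Longrightarrow> (Zero # w, [Zero]) \<in> (step n)\<^sup>*"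
proof (induction w)
  case (Cons c w)
  have "([Zero, c], [Zero]) \<in> rules n"
    using Cons by (auto simp: rules_def Sig0_def)
  from step_rule_append[OF this, of w] Cons show ?case
    by (auto intro: converse_rtrancl_into_rtrancl)
qed auto

text \<open>Rewriting simulates \<open>act\<close>: a zero absorbs its neighbours, an inverse pair
  is deleted, a mismatched pair becomes zero. In the remaining clauses \<open>c # word_of s\<close>
  is already the word of a normal form.\<close>

lemma steps_act:
  assumes "c \<in> Sig0 n" "valid n s"
  shows "(c # word_of s, word_of (act c s)) \<in> (step n)\<^sup>*"
  using assms
proof (cases "(c, s)" rule: act.cases)
  case (1 c')
  have "([c, Zero], [Zero]) \<in> rules n"
    using assms by (auto simp: rules_def Sig0_def)
  from step_rule_append[OF this, of "[]"] 1 show ?thesis by auto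
next
  case (2 p)
  then show ?thesis
    using Zero_absorbs[OF word_of_in_lists[OF assms(2)]] by simp
next
  case (5 i j y x)
  let ?w = "map Gen y @ rev (map GenInv x)"
  have w: "?w \<in> lists (Sig0 n)"
    using word_of_in_lists[of n "Some (y, x)"] 5 assms by simp
  show ?thesis
  proof (cases "i = j")
    case True
    then have "([GenInv i, Gen j], []) \<in> rules n"
      using 5 assms by (auto simp: rules_def Sig0_iff)
    from step_rule_append[OF this w] True 5 show ?thesis by auto
  next
    case False
    then have "([GenInv i, Gen j], [Zero]) \<in> rules n"
      using 5 assms by (auto simp: rules_def Sig0_iff)
    from step_rule_append[OF this w] Zero_absorbs[OF w] False 5 show ?thesis
      by (auto intro: converse_rtrancl_into_rtrancl)
  qed
qed auto

lemma steps_nf: "w \<in> lists (Sig0 n) \<Longrightarrow> (w, word_of (nf w)) \<in> (step n)\<^sup>*"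
proof (induction w)
  case (Cons c w)
  then have "(c # w, c # word_of (nf w)) \<in> (step n)\<^sup>*"
    by (auto intro: steps_Cons)
  also have "(c # word_of (nf w), word_of (nf (c # w))) \<in> (step n)\<^sup>*"
    using steps_act[of c n "nf w"] Cons valid_nf[of w n] by (auto simp: nf_def)
  finally show ?case .
qed (simp add: nf_def)

text \<open>A step to \<open>v\<close> preserves \<open>nf\<close>, so \<open>v\<close> would
  rewrite back to \<open>word_of s\<close>, although steps shorten words.\<close>

lemma irreducible_word_of:
  assumes "valid n s" shows "irreducible_word n (word_of s)"
proof -
  have False if "(word_of s, v) \<in> step n" for v
  proof -
    have "(v, word_of s) \<in> (step n)\<^sup>*"
      using steps_nf[OF step_in_lists[OF that]] nf_step[OF that] by simp
    then show False
      using length_step[OF that] length_steps by fastforce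
  qed
  then show ?thesis
    using word_of_in_lists[OF assms] by (auto simp: irreducible_word_def)
qed

lemma irreducible_wordD:
  assumes "irreducible_word n w" shows "word_of (nf w) = w"
  using steps_nf[of w n] assms
  by (auto simp: irreducible_word_def elim: converse_rtranclE)

lemma reduce_eq:
  assumes "w \<in> lists (Sig0 n)" shows "reduce n w = word_of (nf w)"
  unfolding reduce_def
proof (rule the_equality)
  show "(w, word_of (nf w)) \<in> (step n)\<^sup>* \<and> irreducible_word n (word_of (nf w))"
    using assms by (intro conjI steps_nf irreducible_word_of valid_nf)
  show "v = word_of (nf w)" if "(w, v) \<in> (step n)\<^sup>* \<and> irreducible_word n v" for v
    using that nf_steps irreducible_wordD by metis
qed

text \<open>\<open>nf\<close> is a complete invariant of the congruence: words with equal
  \<open>nf\<close> rewrite to the same word.\<close>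

lemma cong_rel_iff:
  "(u, v) \<in> cong_rel n \<longleftrightarrow> u \<in> lists (Sig0 n) \<and> v \<in> lists (Sig0 n) \<and> nf u = nf v"
proof -
  have "nf u = nf v" if "(u, v) \<in> (step n \<union> (step n)\<inverse>)\<^sup>*"
    using that by (induction rule: rtrancl_induct) (auto dest: nf_step)
  moreover have "(u, v) \<in> (step n \<union> (step n)\<inverse>)\<^sup>*"
    if "u \<in> lists (Sig0 n)" "v \<in> lists (Sig0 n)" "nf u = nf v"
  proof -
    have "(u, word_of (nf u)) \<in> (step n \<union> (step n)\<inverse>)\<^sup>*"
      using steps_nf[OF that(1)] by (rule rtrancl_mono[THEN subsetD, rotated]) auto
    moreover have "(word_of (nf v), v) \<in> ((step n)\<inverse>)\<^sup>*"
      using steps_nf[OF that(2)] by (simp add: rtrancl_converse)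
    then have "(word_of (nf v), v) \<in> (step n \<union> (step n)\<inverse>)\<^sup>*"
      by (rule rtrancl_mono[THEN subsetD, rotated]) auto
    ultimately show ?thesis using that(3) by simp
  qed
  ultimately show ?thesis by (auto simp: cong_rel_def)
qed

section \<open>The polycyclic monoid in terms of normal forms\<close>

definition cls :: "nat \<Rightarrow> nform \<Rightarrow> word set" where
  "cls n s = {w \<in> lists (Sig0 n). nf w = s}"

lemma cong_rel_Image: "w \<in> lists (Sig0 n) \<Longrightarrow> cong_rel n `` {w} = cls n (nf w)"
  by (auto simp: cls_def cong_rel_iff)

lemma carrier_polycyclic: "carrier (polycyclic n) = cls n ` {s. valid n s}"
proof -
  have "carrier (polycyclic n) = (\<lambda>w. cls n (nf w)) ` lists (Sig0 n)"
    by (auto simp: polycyclic_def quotient_def cong_rel_Image)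
  also have "\<dots> = cls n ` {s. valid n s}"
  proof (intro equalityI subsetI)
    fix X assume "X \<in> cls n ` {s. valid n s}"
    then obtain s where s: "valid n s" "X = cls n (nf (word_of s))"
      by auto
    from s(2) word_of_in_lists[OF s(1)] show "X \<in> (\<lambda>w. cls n (nf w)) ` lists (Sig0 n)"
      by (rule image_eqI)
  qed (use valid_nf in \<open>auto simp del: in_lists_conv_set\<close>)
  finally show ?thesis .
qed

lemma word_of_in_cls: "valid n s \<Longrightarrow> word_of s \<in> cls n s"
  by (simp add: cls_def word_of_in_lists del: in_lists_conv_set)

lemma cls_inject: "valid n s \<Longrightarrow> cls n s = cls n t \<longleftrightarrow> s = t"
  using word_of_in_cls[of n s] unfolding cls_def by (metis (mono_tags) mem_Collect_eq)

lemma irr_cls: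
  assumes "valid n s" shows "irr n (cls n s) = word_of s"
  unfolding irr_def
proof (rule the_equality)
  show "word_of s \<in> cls n s \<and> irreducible_word n (word_of s)"
    using assms by (intro conjI word_of_in_cls irreducible_word_of)
  show "w = word_of s" if "w \<in> cls n s \<and> irreducible_word n w" for w
    using that irreducible_wordD[of n w] by (simp add: cls_def)
qed

definition mul :: "nform \<Rightarrow> nform \<Rightarrow> nform" where
  "mul s t = foldr act (word_of s) t"

lemma mul_None [simp]: "mul None t = None" "mul s None = None"
  by (auto simp: mul_def)

text \<open>The action of a word depends only on its normal form, so \<open>mul\<close> describes
  the product of classes.\<close>

lemma foldr_act_nf:
  assumes "u \<in> lists (Sig0 n)"
  shows "foldr act (word_of (nf u)) t = foldr act u t"
proof -
  have "foldr act v t = foldr act u t" if "(u, v) \<in> (step n)\<^sup>*" for v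
    using that
    by (induction rule: rtrancl_induct) (auto simp: step_def foldr_act_rules)
  then show ?thesis using steps_nf[OF assms] by blast
qed

lemma nf_append_mul: "u \<in> lists (Sig0 n) \<Longrightarrow> nf (u @ v) = mul (nf u) (nf v)"
  by (simp add: nf_append mul_def foldr_act_nf)

lemma mult_cls:
  assumes "valid n s" "valid n t"
  shows "cls n s \<otimes>\<^bsub>polycyclic n\<^esub> cls n t = cls n (mul s t)"
proof -
  have "cong_rel n `` {u @ v} = cls n (mul s t)" if "u \<in> cls n s" "v \<in> cls n t" for u v
    using that nf_append_mul[of u n v] by (subst cong_rel_Image) (auto simp: cls_def)
  then have "cls n s \<otimes>\<^bsub>polycyclic n\<^esub> cls n t = (\<Union>u \<in> cls n s. \<Union>v \<in> cls n t. cls n (mul s t))"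
    by (simp add: polycyclic_def cong: SUP_cong_simp)
  moreover have "cls n s \<noteq> {}" "cls n t \<noteq> {}"
    using assms word_of_in_cls by blast+
  ultimately show ?thesis by simp
qed

lemma pconj_cls:
  assumes "valid n A" "valid n B"
  shows "pconj (polycyclic n) (cls n A) (cls n B) \<longleftrightarrow>
    (\<exists>s t. valid n s \<and> valid n t \<and> A = mul s t \<and> B = mul t s)"
  using assms
  by (auto simp: pconj_def carrier_polycyclic mult_cls cls_inject cong: conj_cong)

section \<open>Product formulas\<close>

lemma foldr_act_GenInv:
  "foldr act (rev (map GenInv w)) (Some (w @ z, x)) = Some (z, x)"
  "foldr act (rev (map GenInv (y @ z))) (Some (y, x)) = Some ([], x @ z)"
proof -
  show *: "foldr act (rev (map GenInv w)) (Some (w @ z, x)) = Some (z, x)" for w z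
    by (induction w) auto
  show "foldr act (rev (map GenInv (y @ z))) (Some (y, x)) = Some ([], x @ z)"
    using *[of y "[]"] by simp
qed

text \<open>The inverse letters cancel the common prefix from the left; incomparability ensures that
  a mismatch, and hence zero, is reached before either list ends.\<close>

lemma foldr_act_GenInv_parallel:
  "w \<parallel> y \<Longrightarrow> foldr act (rev (map GenInv w)) (Some (y, x)) = None"
proof (induction w arbitrary: y)
  case (Cons i w)
  show ?case
  proof (cases y)
    case (Cons j y')
    with Cons.IH[of y'] Cons.prems show ?thesis by (auto simp: parallel_def)
  qed (use Cons.prems in auto)
qed auto

lemma mul_simps:
  "mul (Some (y1, x1)) (Some (x1 @ z, x2)) = Some (y1 @ z, x2)"
  "mul (Some (y1, y2 @ z)) (Some (y2, x2)) = Some (y1, x2 @ z)"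
  "mul (Some (y1, x1)) (Some (x1, x2)) = Some (y1, x2)"
  using foldr_act_GenInv(1)[of x1 "[]"]
  by (simp_all add: mul_def foldr_act_GenInv del: map_append)

lemma mul_parallel: "x1 \<parallel> y2 \<Longrightarrow> mul (Some (y1, x1)) (Some (y2, x2)) = None"
  by (simp add: mul_def foldr_act_GenInv_parallel)

section \<open>Conjugacy of normal forms\<close>

lemma prefix_trichotomy:
  obtains z where "y = x @ z" | z where "x = y @ z" | "x \<parallel> y"
  by (metis parallelI prefix_def)

text \<open>The possible pairs \<open>uv\<close>, \<open>vu\<close>. A common prefix stands for
  conjugation, since \<open>(r @ y, r @ x)\<close> is \<open>r y x^-1 r^-1\<close>; it need not be
  the longest one.\<close>

inductive conj_nf :: "nform \<Rightarrow> nform \<Rightarrow> bool" where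
  zero: "conj_nf None None"
| zero_left: "x \<parallel> y \<Longrightarrow> conj_nf None (Some (y, x))"
| zero_right: "x \<parallel> y \<Longrightarrow> conj_nf (Some (y, x)) None"
| same: "conj_nf (Some (r @ y, r @ x)) (Some (s @ y, s @ x))"
| pos: "conj_nf (Some (r @ w @ z, r)) (Some (s @ z @ w, s))"
| neg: "conj_nf (Some (r, r @ w @ z)) (Some (s, s @ z @ w))"

lemma parallel_appendI: "x \<parallel> y \<Longrightarrow> x @ z \<parallel> y" "x \<parallel> y \<Longrightarrow> x \<parallel> y @ z"
  using parallel_append[of x y z "[]"] parallel_append[of x y "[]" z] by auto

text \<open>If \<open>x1^-1 y2\<close> and \<open>x2^-1 y1\<close> are both nonzero, they are both
  positive, both negative or of opposite signs, which gives \<open>pos\<close>, \<open>neg\<close>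
  or \<open>same\<close>. If just one vanishes, the other product has incomparable components,
  because appending to incomparable lists leaves them incomparable.\<close>

lemma conj_nf_mul: "conj_nf (mul s t) (mul t s)"
proof (cases s rule: word_of.cases; cases t rule: word_of.cases)
  fix y1 x1 y2 x2
  assume s: "s = Some (y1, x1)" and t: "t = Some (y2, x2)"
  show ?thesis
    unfolding s t
    by (rule prefix_trichotomy[of y2 x1]; rule prefix_trichotomy[of y1 x2])
      (auto simp: mul_simps mul_parallel parallel_appendI parallel_commute
        intro: conj_nf.intros
          same[where y = "[]", simplified] same[where x = "[]", simplified])
qed (auto intro: conj_nf.intros)

lemma mul_conj_nf:
  assumes "conj_nf A B" "valid n A" "valid n B"
  shows "\<exists>s t. valid n s \<and> valid n t \<and> A = mul s t \<and> B = mul t s"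
  using assms
proof cases
  case zero
  then show ?thesis by (intro exI[of _ None]) auto
next
  case (zero_left x y)
  \<comment> \<open>Zero is obtained as \<open>x^-1 y\<close>, the other element as
    \<open>y x^-1\<close>.\<close>
  then show ?thesis using assms mul_simps(3)[of y "[]" x]
    by (intro exI[of _ "Some ([], x)"] exI[of _ "Some (y, [])"]) (auto simp: mul_parallel)
next
  case (zero_right x y)
  then show ?thesis using assms mul_simps(3)[of y "[]" x]
    by (intro exI[of _ "Some (y, [])"] exI[of _ "Some ([], x)"]) (auto simp: mul_parallel)
next
  case (same r y x s)
  \<comment> \<open>The factors are \<open>r y x^-1 s^-1\<close> and \<open>s r^-1\<close>; the
    second one exchanges the conjugating prefixes.\<close>
  then show ?thesis using assms
    by (intro exI[of _ "Some (r @ y, s @ x)"] exI[of _ "Some (s, r)"]) (auto simp: mul_simps)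
next
  case (pos r w z s)
  then show ?thesis using assms
    by (intro exI[of _ "Some (r @ w, s)"] exI[of _ "Some (s @ z, r)"]) (auto simp: mul_simps)
next
  case (neg r w z s)
  \<comment> \<open>The factors are \<open>r z^-1 s^-1\<close> and \<open>s w^-1 r^-1\<close>;
    inversion reverses the order of \<open>w\<close> and \<open>z\<close>.\<close>
  then show ?thesis using assms
    by (intro exI[of _ "Some (r, s @ z)"] exI[of _ "Some (s, r @ w)"]) (auto simp: mul_simps)
qed

lemma pconj_cls_iff_conj_nf:
  "valid n A \<Longrightarrow> valid n B \<Longrightarrow> pconj (polycyclic n) (cls n A) (cls n B) \<longleftrightarrow> conj_nf A B"
  using mul_conj_nf by (auto simp: pconj_cls conj_nf_mul)

section \<open>The functions \<open>rho\<close> and \<open>tilde\<close> on normal forms\<close>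

lemma word_of_eq_inv_word: "map Gen y @ inv_word (map Gen x) = word_of (Some (y, x))"
  by simp

text \<open>The decomposition \<open>y x^-1\<close> of a word is unique because
  \<open>word_of\<close> is injective, and reducing \<open>x^-1 y\<close> is a product of normal
  forms.\<close>

lemma rho_Some:
  assumes "valid n (Some (y, x))"
  shows "rho n (word_of (Some (y, x))) = word_of (mul (Some ([], x)) (Some (y, [])))"
proof -
  have *: "inv_word (map Gen x) @ map Gen y \<in> lists (Sig0 n)"
    using assms by (auto simp: Sig0_iff subset_iff)
  have "nf (inv_word (map Gen x) @ map Gen y) = mul (Some ([], x)) (Some (y, []))"
    by (simp add: nf_append mul_def) (simp add: nf_def)
  then have red: "reduce n (inv_word (map Gen x) @ map Gen y) =
      word_of (mul (Some ([], x)) (Some (y, [])))"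
    by (simp only: reduce_eq[OF *])
  have "word_of (Some (y, x)) \<noteq> [Zero]"
    using word_of_inject[of _ None] by (metis option.distinct(1) word_of.simps(1))
  then have "rho n (word_of (Some (y, x))) =
      (THE v. \<exists>x' \<in> lists (gens n). \<exists>y' \<in> lists (gens n).
        word_of (Some (y, x)) = y' @ inv_word x' \<and> v = reduce n (inv_word x' @ y'))"
    by (simp only: rho_def if_False)
  also have "\<dots> = reduce n (inv_word (map Gen x) @ map Gen y)"
  proof (rule the_equality, goal_cases)
    case 1
    then show ?case
      using assms unfolding lists_gens
      by (intro bexI[of _ "map Gen x"] bexI[of _ "map Gen y"]) auto
  next
    case (2 v)
    then obtain x' y' where "word_of (Some (y, x)) = word_of (Some (y', x'))"
      "v = reduce n (inv_word (map Gen x') @ map Gen y')"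
      unfolding lists_gens word_of_eq_inv_word[symmetric] by auto
    then show ?case
      by (simp only: word_of_inject option.inject prod.inject)
  qed
  finally show ?thesis
    by (simp only: red)
qed

lemma rho_eq_Zero_iff:
  assumes "valid n (Some (y, x))"
  shows "rho n (word_of (Some (y, x))) = [Zero] \<longleftrightarrow> x \<parallel> y"
proof -
  have "mul (Some ([], x)) (Some (y, [])) = None \<longleftrightarrow> x \<parallel> y"
    by (rule prefix_trichotomy[of y x]) (auto simp: mul_simps mul_parallel)
  then show ?thesis
    using rho_Some[OF assms] word_of_inject[of _ None] by simp
qed

text \<open>Cyclic reducedness of \<open>y x^-1\<close>: this word starts with the head of
  \<open>y\<close> and ends with the inverse of the head of \<open>x\<close>. If exactly one list is
  empty, both end letters have the same sign and cannot be mutually inverse.\<close>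

definition stripped :: "nat list \<Rightarrow> nat list \<Rightarrow> bool" where
  "stripped y x \<longleftrightarrow> y = [] \<or> x = [] \<or> hd y \<noteq> hd x"

text \<open>Nonempty lists with different heads are incomparable. An empty list leads to (c) or (d)
  of the theorem, incomparability to (b).\<close>

lemma stripped_cases:
  assumes "stripped y x"
  obtains "y = []" | "x = []" | "x \<parallel> y"
  using assms by (cases x; cases y) (auto simp: stripped_def parallel_def)

lemma stripped_exists: "\<exists>r y' x'. y = r @ y' \<and> x = r @ x' \<and> stripped y' x'"
proof (induction y arbitrary: x)
  case (Cons i y)
  show ?case
  proof (cases x)
    case (Cons j x')
    with Cons.IH[of x'] show ?thesis
      by (cases "i = j") (metis append_Cons, fastforce simp: stripped_def)
  qed (auto simp: stripped_def)
qed (auto simp: stripped_def)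

text \<open>One of \<open>r\<close>, \<open>r'\<close> extends the other by some \<open>p\<close>,
  and a nonempty \<open>p\<close> would give a stripped pair a common head.\<close>

lemma stripped_unique:
  assumes "r @ y = r' @ y'" "r @ x = r' @ x'" "stripped y x" "stripped y' x'"
  shows "r = r' \<and> y = y' \<and> x = x'"
proof -
  have *: "p = []" if "stripped (p @ u) (p @ v)" for p u v
    using that by (cases p) (auto simp: stripped_def)
  from assms(1) obtain p where "r = r' @ p \<and> p @ y = y' \<or> r @ p = r' \<and> y = p @ y'"
    by (auto simp: append_eq_append_conv2)
  then show ?thesis
    using assms *[of p y x] *[of p y' x'] by auto
qed

lemma cyclically_reduced_word_of:
  assumes "valid n (Some (y, x))"
  shows "cyclically_reduced n (word_of (Some (y, x))) \<longleftrightarrow> stripped y x"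
  using irreducible_word_of[OF assms]
  by (cases y; cases x)
    (auto simp: cyclically_reduced_def stripped_def last_rev hd_rev last_map hd_append)

lemma tilde_None [simp]: "tilde n (word_of None) = word_of None"
  using irreducible_word_of[of n None] by (simp add: tilde_def cyclically_reduced_def)

text \<open>Conjugating by \<open>r\<close> prepends it to both components, so uniqueness of
  stripping evaluates the description in \<open>tilde\<close>. For a cyclically reduced word it
  forces \<open>r\<close> to be empty.\<close>

lemma tilde_Some:
  assumes "valid n (Some (r @ y, r @ x))" "stripped y x"
  shows "tilde n (word_of (Some (r @ y, r @ x))) = word_of (Some (y, x))"
proof (cases "cyclically_reduced n (word_of (Some (r @ y, r @ x)))")
  case True
  then have "stripped (r @ y) (r @ x)"
    using cyclically_reduced_word_of assms by blast
  then have "r = []"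
    using stripped_unique[of "[]" "r @ y" r y "r @ x" x] assms by simp
  then show ?thesis using True by (simp add: tilde_def)
next
  case False
  have conjugate: "map Gen r' @ word_of (Some (y', x')) @ inv_word (map Gen r') =
      word_of (Some (r' @ y', r' @ x'))" for r' y' x'
    by simp
  have "(THE t. \<exists>r \<in> lists (gens n). \<exists>x \<in> lists (gens n). \<exists>y \<in> lists (gens n).
      t = y @ inv_word x \<and> cyclically_reduced n t \<and>
      word_of (Some (r' @ y', r' @ x')) = r @ t @ inv_word r) = word_of (Some (y', x'))"
    if "valid n (Some (r' @ y', r' @ x'))" "stripped y' x'" for r' y' x'
  proof (rule the_equality, goal_cases)
    case 1
    have "cyclically_reduced n (word_of (Some (y', x')))"
      using that by (subst cyclically_reduced_word_of) auto
    with that show ?case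
      unfolding lists_gens
      by (intro bexI[of _ "map Gen r'"] bexI[of _ "map Gen x'"] bexI[of _ "map Gen y'"])
        (auto simp del: word_of.simps inv_word_map_Gen simp: conjugate word_of_eq_inv_word)
  next
    case (2 t)
    then obtain r2 x2 y2 where *: "set r2 \<subseteq> {1..n}" "set x2 \<subseteq> {1..n}" "set y2 \<subseteq> {1..n}"
      "t = word_of (Some (y2, x2))" "cyclically_reduced n t"
      "word_of (Some (r' @ y', r' @ x')) = map Gen r2 @ t @ inv_word (map Gen r2)"
      unfolding lists_gens by (auto simp del: word_of.simps simp: word_of_eq_inv_word
          simp del: inv_word_map_Gen)
    then have "stripped y2 x2"
      using cyclically_reduced_word_of[of n y2 x2] by simp
    moreover have "r' @ y' = r2 @ y2 \<and> r' @ x' = r2 @ x2"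
      using *(6) unfolding *(4) conjugate word_of_inject by simp
    ultimately show ?case
      using stripped_unique that(2) *(4) by metis
  qed
  then show ?thesis
    using False assms by (simp only: tilde_def if_False)
qed

section \<open>Conjugacy in free monoids and of stripped pairs\<close>

lemma pconj_free_monoid:
  "pconj (free_monoid X) a b \<longleftrightarrow> (\<exists>u \<in> lists X. \<exists>v \<in> lists X. a = u @ v \<and> b = v @ u)"
  by (simp add: pconj_def free_monoid_def)

lemma pconj_free_monoid_map:
  assumes "inj f" "set u \<subseteq> X"
  shows "pconj (free_monoid (f ` X)) (map f u) (map f v) \<longleftrightarrow> (\<exists>w z. u = w @ z \<and> v = z @ w)"
proof
  assume "pconj (free_monoid (f ` X)) (map f u) (map f v)"
  then obtain w z where "map f u = map f (w @ z)" "map f v = map f (z @ w)"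
    by (auto simp: pconj_free_monoid lists_image simp del: in_lists_conv_set)
  then show "\<exists>w z. u = w @ z \<and> v = z @ w"
    using assms(1) by (metis inj_map_eq_map)
next
  assume "\<exists>w z. u = w @ z \<and> v = z @ w"
  then obtain w z where "u = w @ z" "v = z @ w" by blast
  then show "pconj (free_monoid (f ` X)) (map f u) (map f v)"
    using assms(2) unfolding pconj_free_monoid
    by (intro bexI[of _ "map f w"] bexI[of _ "map f z"]) (auto simp: subset_iff)
qed

lemma pconj_free_gens:
  assumes "set y \<subseteq> {1..n}"
  shows "pconj (free_monoid (gens n)) (map Gen y) (map Gen y') \<longleftrightarrow>
    (\<exists>w z. y = w @ z \<and> y' = z @ w)"
  unfolding gens_def by (rule pconj_free_monoid_map) (use assms in \<open>auto simp: inj_def\<close>)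

text \<open>Inversion reverses \<open>x\<close>, and reversing a rotation gives a rotation of the
  reversed list.\<close>

lemma pconj_free_inv_gens:
  assumes "set x \<subseteq> {1..n}"
  shows "pconj (free_monoid (inv_gens n)) (rev (map GenInv x)) (rev (map GenInv x')) \<longleftrightarrow>
    (\<exists>w z. x = w @ z \<and> x' = z @ w)"
proof -
  have "pconj (free_monoid (inv_gens n)) (map GenInv (rev x)) (map GenInv (rev x')) \<longleftrightarrow>
    (\<exists>w z. rev x = w @ z \<and> rev x' = z @ w)"
    unfolding inv_gens_def by (rule pconj_free_monoid_map) (use assms in \<open>auto simp: inj_def\<close>)
  also have "\<dots> \<longleftrightarrow> (\<exists>w z. x = w @ z \<and> x' = z @ w)"
    by (metis rev_append rev_rev_ident)
  finally show ?thesis by (simp only: rev_map)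
qed

lemma word_of_in_gens_iff:
  "word_of (Some (y, x)) \<in> lists (gens n) \<longleftrightarrow> set y \<subseteq> {1..n} \<and> x = []"
  by (cases x) (auto simp: gens_def subset_iff image_iff)

lemma word_of_in_inv_gens_iff:
  "word_of (Some (y, x)) \<in> lists (inv_gens n) \<longleftrightarrow> set x \<subseteq> {1..n} \<and> y = []"
  by (cases y) (auto simp: inv_gens_def subset_iff image_iff)

text \<open>Every nonzero case of \<open>conj_nf\<close> decomposes both arguments, and uniqueness
  of stripping matches this with the given decompositions.\<close>

lemma conj_nf_Some_iff:
  assumes "stripped y x" "stripped y' x'"
  shows "conj_nf (Some (r @ y, r @ x)) (Some (s @ y', s @ x')) \<longleftrightarrow>
    y = y' \<and> x = x' \<or>
    x = [] \<and> x' = [] \<and> (\<exists>w z. y = w @ z \<and> y' = z @ w) \<or>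
    y = [] \<and> y' = [] \<and> (\<exists>w z. x = w @ z \<and> x' = z @ w)" (is "?L \<longleftrightarrow> ?R")
proof
  assume ?L
  then show ?R
  proof (cases (no_simp))
    case (same r0 y0 x0 s0)
    \<comment> \<open>In \<open>same\<close> the lists \<open>y0\<close> and \<open>x0\<close> may
      still share a prefix, which is split off as \<open>q\<close>.\<close>
    obtain q y1 x1 where "y0 = q @ y1" "x0 = q @ x1" "stripped y1 x1"
      using stripped_exists by metis
    then show ?R
      using stripped_unique[of r y "r0 @ q" y1 x x1] stripped_unique[of s y' "s0 @ q" y1 x' x1]
        same assms by simp
  next
    case (pos r0 w z s0)
    then show ?R
      using stripped_unique[of r y r0 "w @ z" x "[]"] stripped_unique[of s y' s0 "z @ w" x' "[]"]
        assms by (auto simp: stripped_def)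
  next
    case (neg r0 w z s0)
    then show ?R
      using stripped_unique[of r y r0 "[]" x "w @ z"] stripped_unique[of s y' s0 "[]" x' "z @ w"]
        assms by (auto simp: stripped_def)
  qed simp_all
next
  assume ?R
  then show ?L
    using pos[of r _ _ s] neg[of r _ _ s] by (auto intro: same)
qed

section \<open>Matching with the four conditions\<close>

lemma conj_nf_None_iff:
  "conj_nf None None"
  "conj_nf None (Some (y, x)) \<longleftrightarrow> x \<parallel> y"
  "conj_nf (Some (y, x)) None \<longleftrightarrow> x \<parallel> y"
  by (auto intro: conj_nf.intros elim: conj_nf.cases)

theorem theorem3p6:
  fixes n :: nat and a b :: "word set"
  assumes "n \<ge> 2"
    and "a \<in> carrier (polycyclic n)" and "b \<in> carrier (polycyclic n)"
  shows "pconj (polycyclic n) a b \<longleftrightarrow>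
      ((irr n a = [Zero] \<and> rho n (irr n b) = [Zero]) \<or>
       (rho n (irr n a) = [Zero] \<and> irr n b = [Zero])) \<or>
      (rho n (irr n a) = [Zero] \<and> rho n (irr n b) = [Zero] \<and>
       tilde n (irr n a) = tilde n (irr n b)) \<or>
      (tilde n (irr n a) \<in> lists (gens n) \<and> tilde n (irr n b) \<in> lists (gens n) \<and>
       pconj (free_monoid (gens n)) (tilde n (irr n a)) (tilde n (irr n b))) \<or>
      (tilde n (irr n a) \<in> lists (inv_gens n) \<and> tilde n (irr n b) \<in> lists (inv_gens n) \<and>
       pconj (free_monoid (inv_gens n)) (tilde n (irr n a)) (tilde n (irr n b)))"
proof -
  obtain A B where A: "valid n A" "a = cls n A" and B: "valid n B" "b = cls n B"
    using assms by (auto simp: carrier_polycyclic)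
  have zero_iff: "word_of s = [Zero] \<longleftrightarrow> s = None" for s
    using word_of_inject[of s None] by simp
  have rho_None: "rho n (word_of None) = [Zero]"
    by (simp add: rho_def)
  have not_gens: "word_of None \<notin> lists (gens n)" "word_of None \<notin> lists (inv_gens n)"
    by (auto simp: gens_def inv_gens_def)
  note trivial_simps = zero_iff rho_None rho_eq_Zero_iff not_gens tilde_None conj_nf_None_iff
  note goal_simps = A(2) B(2) pconj_cls_iff_conj_nf[OF A(1) B(1)] irr_cls[OF A(1)] irr_cls[OF B(1)]
  show ?thesis
  proof (cases "A = None \<or> B = None")
    case True
    \<comment> \<open>\<open>Zero\<close> belongs to neither alphabet, so (c) and (d) fail; here (b)
      implies (a).\<close>
    then show ?thesis
      unfolding goal_simps using A(1) B(1)
      by (cases A; cases B) (auto simp: trivial_simps simp del: word_of.simps)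
  next
    case False
    then obtain r y x s y' x' where
      A': "A = Some (r @ y, r @ x)" "stripped y x" and
      B': "B = Some (s @ y', s @ x')" "stripped y' x'"
      using stripped_exists by (metis not_None_eq surj_pair)
    have val: "set y \<subseteq> {1..n}" "set x \<subseteq> {1..n}" "set y' \<subseteq> {1..n}" "set x' \<subseteq> {1..n}"
      using A(1) B(1) A' B' by auto
    \<comment> \<open>A common prefix does not affect incomparability, so the vanishing of
      \<open>rho\<close> can be tested on stripped pairs.\<close>
    have par: "q @ u \<parallel> q @ v \<longleftrightarrow> u \<parallel> v" for q u v :: "nat list"
      by (simp add: parallel_def)
    have rho: "rho n (word_of A) = [Zero] \<longleftrightarrow> x \<parallel> y" "rho n (word_of B) = [Zero] \<longleftrightarrow> x' \<parallel> y'"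
      using A(1) B(1) unfolding A' B' by (simp_all only: rho_eq_Zero_iff par)
    have tilde: "tilde n (word_of A) = word_of (Some (y, x))"
        "tilde n (word_of B) = word_of (Some (y', x'))"
      using tilde_Some A(1) B(1) A' B' by simp_all
    have nonzero: "A \<noteq> None" "B \<noteq> None" using A' B' by auto
    have free: "x = [] \<and> x' = [] \<and>
        pconj (free_monoid (gens n)) (word_of (Some (y, x))) (word_of (Some (y', x')))
        \<longleftrightarrow> x = [] \<and> x' = [] \<and> (\<exists>w z. y = w @ z \<and> y' = z @ w)"
      using pconj_free_gens[OF val(1), of y'] by (intro conj_cong refl) simp
    have inv_free: "y = [] \<and> y' = [] \<and>
        pconj (free_monoid (inv_gens n)) (word_of (Some (y, x))) (word_of (Some (y', x')))
        \<longleftrightarrow> y = [] \<and> y' = [] \<and> (\<exists>w z. x = w @ z \<and> x' = z @ w)"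
      using pconj_free_inv_gens[OF val(2), of x'] by (intro conj_cong refl) simp
    \<comment> \<open>Equal stripped pairs are either incomparable, which is (b), or have an empty
      component, which is (c) or (d) with a trivial rotation.\<close>
    have same_cases: "y = y' \<and> x = x' \<longrightarrow>
        x \<parallel> y \<and> x' \<parallel> y' \<or> x = [] \<and> x' = [] \<or> y = [] \<and> y' = []"
      using A'(2) by (auto elim: stripped_cases)
    have "conj_nf A B \<longleftrightarrow> y = y' \<and> x = x' \<or>
        x = [] \<and> x' = [] \<and> (\<exists>w z. y = w @ z \<and> y' = z @ w) \<or>
        y = [] \<and> y' = [] \<and> (\<exists>w z. x = w @ z \<and> x' = z @ w)"
      unfolding A'(1) B'(1) by (rule conj_nf_Some_iff[OF A'(2) B'(2)])
    also have "\<dots> \<longleftrightarrow> x \<parallel> y \<and> x' \<parallel> y' \<and> y = y' \<and> x = x' \<or>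
        x = [] \<and> x' = [] \<and> (\<exists>w z. y = w @ z \<and> y' = z @ w) \<or>
        y = [] \<and> y' = [] \<and> (\<exists>w z. x = w @ z \<and> x' = z @ w)"
      using same_cases by (metis append_Nil append_Nil2)
    finally show ?thesis
      unfolding goal_simps rho tilde zero_iff word_of_in_gens_iff word_of_in_inv_gens_iff
      using free inv_free val nonzero by (auto simp del: word_of.simps)
  qed
qed

end
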